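(* Let $n,p\in\mathbb{N}$, $\boldsymbol{d}\in\mathbb{R}^n_+$, $\boldsymbol{w}\in\mathbb{N}^n$, $B\in\mathbb{N}$, with $w_1\le w_2\le\cdots\le w_n\le B$, let $\mathcal{X}\subseteq\{0,1\}^n$, and let $\mathcal{U}=\left\{\boldsymbol{c}\in\{0,1\}^n : \sum_{i=1}^n w_ic_i\le B\right\}$. Then the integer program $$\begin{aligned} \min\ &\sum_{i=1}^n d_ix_i\\ \text{s.t. } &\sum_{i=1}^n x_i\ge p+\sum_{k=1}^n y_k,\\ &(B+1)(1-x_k+y_k)\ge B+1-\sum_{i=1}^k w_ix_i\qquad\text{for all } k\in\{1,\ldots,n\},\\ &\boldsymbol{y}\in\{0,1\}^n,\ \boldsymbol{x}\in\mathcal{X} \end{aligned}$$ is a correct formulation of the robust problem $$\min\left\{\sum_{i=1}^n d_ix_i : \sum_{i=1}^n(1-c_i)x_i\ge p\ \text{ for all }\boldsymbol{c}\in\mathcal{U},\ \boldsymbol{x}\in\mathcal{X}\right\}.$$ That is, a vector $\boldsymbol{x}\in\mathcal{X}$ is feasible for the robust problem if and only if there exists $\boldsymbol{y}\in\{0,1\}^n$ such that $(\boldsymbol{x},\boldsymbol{y})$ is feasible for the integer program.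
   Context: The robust problem has an uncertain cardinality constraint $\sum_{i=1}^n x_i\ge p$: an adversary may let any set of items fail (indicated by $\boldsymbol{c}$) whose total weight with respect to $\boldsymbol{w}$ does not exceed the budget $B$, and at least $p$ selected items must survive every such attack. *)

theory Defs
  imports Complex_Main "HOL-Library.FuncSet"
begin

text \<open>
  A vector indexed by \<open>1, \<dots>, n\<close> is a function on \<open>{1..n}\<close>. Binary vectors are taken to be
  extensional, so that distinct elements of the set below differ at some index in \<open>{1..n}\<close>.
  Their entries are real numbers, so that subtraction is not truncated.
\<close>

definition binary_vectors :: "nat \<Rightarrow> (nat \<Rightarrow> real) set" where
  "binary_vectors n = {1..n} \<rightarrow>\<^sub>E {0, 1}"

definition uncertainty_set :: "nat \<Rightarrow> (nat \<Rightarrow> nat) \<Rightarrow> nat \<Rightarrow> (nat \<Rightarrow> real) set" where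
  "uncertainty_set n w B =
     {c \<in> binary_vectors n. (\<Sum>i=1..n. real (w i) * c i) \<le> real B}"

definition objective :: "nat \<Rightarrow> (nat \<Rightarrow> real) \<Rightarrow> (nat \<Rightarrow> real) \<Rightarrow> real" where
  "objective n d x = (\<Sum>i=1..n. d i * x i)"

definition robust_feasible ::
  "nat \<Rightarrow> nat \<Rightarrow> (nat \<Rightarrow> nat) \<Rightarrow> nat \<Rightarrow> (nat \<Rightarrow> real) set \<Rightarrow> (nat \<Rightarrow> real) \<Rightarrow> bool" where
  "robust_feasible n p w B X x \<longleftrightarrow>
     x \<in> X \<and> (\<forall>c\<in>uncertainty_set n w B. (\<Sum>i=1..n. (1 - c i) * x i) \<ge> real p)"

definition ip_feasible ::
  "nat \<Rightarrow> nat \<Rightarrow> (nat \<Rightarrow> nat) \<Rightarrow> nat \<Rightarrow> (nat \<Rightarrow> real) set \<Rightarrow>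
   (nat \<Rightarrow> real) \<Rightarrow> (nat \<Rightarrow> real) \<Rightarrow> bool" where
  "ip_feasible n p w B X x y \<longleftrightarrow>
     (\<Sum>i=1..n. x i) \<ge> real p + (\<Sum>k=1..n. y k) \<and>
     (\<forall>k\<in>{1..n}. (real B + 1) * (1 - x k + y k) \<ge> real B + 1 - (\<Sum>i=1..k. real (w i) * x i)) \<and>
     y \<in> binary_vectors n \<and> x \<in> X"

end

(* Against a selection of items, a worst attack is greedy: destroy the lightest selected items as
   long as the budget lasts. The constraints of the integer program force y to be 1 at least on the
   items of this greedy prefix, and the indicator vector of the prefix is itself an attack. *)
theory Submission
  imports Defs
begin

text \<open>Each \<open>k\<close> is tested by its own prefix sum, \<open>k\<close> included,
  instead of by a recursive run of the greedy procedure. This is the sum that appears in the k-th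
  constraint of the integer program. The order is that of the indices, which sorts by weight once
  \<open>w\<close> is monotone.\<close>

definition greedy_prefix :: "('a::linorder \<Rightarrow> nat) \<Rightarrow> nat \<Rightarrow> 'a set \<Rightarrow> 'a set" where
  "greedy_prefix w B I = {k \<in> I. sum w {i \<in> I. i \<le> k} \<le> B}"

lemma mem_greedy_prefix_iff:
  "k \<in> greedy_prefix w B I \<longleftrightarrow> k \<in> I \<and> sum w {i \<in> I. i \<le> k} \<le> B"
  by (simp add: greedy_prefix_def)

lemma greedy_prefix_subset: "greedy_prefix w B I \<subseteq> I"
  by (auto simp: greedy_prefix_def)

text \<open>The whole set lies at or below its largest element, and the prefix sum tested at that
  element already covers it.\<close>

lemma sum_greedy_prefix_le:
  assumes "finite I"
  shows "sum w (greedy_prefix w B I) \<le> B"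
proof (cases "greedy_prefix w B I = {}")
  case False
  let ?G = "greedy_prefix w B I"
  have fin: "finite ?G"
    by (rule finite_subset[OF greedy_prefix_subset assms])
  then have "Max ?G \<in> ?G"
    using False by simp
  then have "sum w {i \<in> I. i \<le> Max ?G} \<le> B"
    by (simp add: mem_greedy_prefix_iff)
  moreover have "sum w ?G \<le> sum w {i \<in> I. i \<le> Max ?G}"
    using assms fin greedy_prefix_subset[of w B I] by (intro sum_mono2) auto
  ultimately show ?thesis
    by simp
qed simp

text \<open>An exchange argument around the first item \<open>m\<close> of \<open>I\<close> that
  greedy rejects: items of \<open>A\<close> outside the prefix weigh at least \<open>w m\<close>
  each, items of the prefix at most \<open>w m\<close> each. A larger \<open>A\<close> would thus
  weigh at least \<open>w m\<close> more than the prefix, which is over budget.\<close>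

lemma card_le_card_greedy_prefix:
  assumes fin: "finite I" and mono: "mono_on I w" and "A \<subseteq> I" and le: "sum w A \<le> B"
  shows "card A \<le> card (greedy_prefix w B I)"
proof (rule ccontr)
  let ?G = "greedy_prefix w B I"
  assume "\<not> ?thesis"
  then have less: "card ?G < card A"
    by simp
  have finA: "finite A" and finG: "finite ?G"
    using finite_subset[OF \<open>A \<subseteq> I\<close> fin] finite_subset[OF greedy_prefix_subset fin] by auto
  have "\<not> A \<subseteq> ?G"
    using less card_mono[OF finG, of A] by linarith
  then have ne: "I - ?G \<noteq> {}"
    using \<open>A \<subseteq> I\<close> by blast
  define m where "m = Min (I - ?G)"
  have m: "m \<in> I" "m \<notin> ?G"
    using Min_in[of "I - ?G"] fin ne by (auto simp: m_def)
  have m_le: "m \<le> i" if "i \<in> I - ?G" for i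
    using that fin by (simp add: m_def)
  \<comment> \<open>Prefix sums grow with the index, so a member of \<open>?G\<close> at or beyond
    \<open>m\<close> would put \<open>m\<close> into \<open>?G\<close> as well.\<close>
  have G_lt: "i < m" if "i \<in> ?G" for i
  proof (rule ccontr)
    assume "\<not> i < m"
    then have "sum w {j \<in> I. j \<le> m} \<le> sum w {j \<in> I. j \<le> i}"
      using fin by (intro sum_mono2) auto
    then show False
      using m that by (simp add: mem_greedy_prefix_iff)
  qed
  \<comment> \<open>Hence the prefix sum that fails the test at \<open>m\<close> is exactly the
    weight of \<open>?G\<close> plus \<open>w m\<close>.\<close>
  have "{i \<in> I. i \<le> m} = insert m ?G"
  proof (intro equalityI subsetI)
    fix i assume "i \<in> {i \<in> I. i \<le> m}"
    then show "i \<in> insert m ?G"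
      using m_le[of i] by auto
  next
    fix i assume "i \<in> insert m ?G"
    then show "i \<in> {i \<in> I. i \<le> m}"
      using m G_lt[of i] greedy_prefix_subset[of w B I] by auto
  qed
  moreover have "\<not> sum w {i \<in> I. i \<le> m} \<le> B"
    using m by (simp add: mem_greedy_prefix_iff)
  ultimately have exceeds: "w m + sum w ?G > B"
    using m finG by simp
  have "card (?G - A) < card (A - ?G)"
    using less card_Diff_subset_Int[of ?G A] card_Diff_subset_Int[of A ?G] finA finG
      card_mono[OF finG, of "?G \<inter> A"] by (simp add: Int_commute)
  \<comment> \<open>The \<open>Suc\<close> stands for the surplus item of \<open>A\<close>: it
    supplies the extra \<open>w m\<close> needed to meet \<open>exceeds\<close>.\<close>
  then have "w m * Suc (card (?G - A)) \<le> w m * card (A - ?G)"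
    by (intro mult_le_mono2) simp
  moreover have "w m * card (A - ?G) \<le> sum w (A - ?G)"
  proof -
    have "w m \<le> w i" if "i \<in> A - ?G" for i
      using that m m_le[of i] \<open>A \<subseteq> I\<close> mono by (auto simp: mono_on_def)
    then show ?thesis
      using sum_bounded_below[of "A - ?G" "w m" w] by (simp add: mult.commute)
  qed
  moreover have "sum w (?G - A) \<le> w m * card (?G - A)"
  proof -
    have "w i \<le> w m" if "i \<in> ?G - A" for i
      using that m G_lt[of i] greedy_prefix_subset[of w B I] mono by (auto simp: mono_on_def)
    then show ?thesis
      using sum_bounded_above[of "?G - A" w "w m"] by (simp add: mult.commute)
  qed
  moreover have "sum w A = sum w (A \<inter> ?G) + sum w (A - ?G)"
    using sum.Int_Diff[OF finA] .
  moreover have "sum w ?G = sum w (A \<inter> ?G) + sum w (?G - A)"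
    using sum.Int_Diff[OF finG, of w A] by (simp add: Int_commute)
  ultimately show False
    using exceeds le by simp
qed

lemma binary_vectors_cases:
  assumes "v \<in> binary_vectors n" and "i \<in> {1..n}"
  obtains "v i = 0" | "v i = 1"
  using PiE_mem[of v "{1..n}" "\<lambda>_. {0, 1}" i] assms by (auto simp: binary_vectors_def)

lemma sum_mult_binary_vector:
  assumes "v \<in> binary_vectors n" and "J \<subseteq> {1..n}"
  shows "(\<Sum>i\<in>J. a i * v i) = sum a {i \<in> J. v i = 1}"
proof -
  have "finite J"
    using assms(2) finite_subset by blast
  moreover have "a i * v i = (if v i = 1 then a i else 0)" if "i \<in> J" for i
    by (rule binary_vectors_cases[OF assms(1) subsetD[OF assms(2) that]]) auto
  ultimately show ?thesis
    by (simp add: sum.inter_filter)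
qed

lemma sum_binary_vector:
  assumes "v \<in> binary_vectors n"
  shows "(\<Sum>i=1..n. v i) = card {i \<in> {1..n}. v i = 1}"
  using sum_mult_binary_vector[OF assms, of "{1..n}" "\<lambda>_. 1"] by simp

text \<open>If \<open>x k = 0\<close> or \<open>y k = 1\<close>, the left factor is at least 1 and
  the constraint holds because the prefix sum is nonnegative. If \<open>x k = 1\<close> and
  \<open>y k = 0\<close>, the left side vanishes and the prefix sum must reach \<open>B + 1\<close>,
  which for integers means exceeding \<open>B\<close>.\<close>

lemma ip_constraint_iff:
  assumes x: "x \<in> binary_vectors n" and y: "y \<in> binary_vectors n" and k: "k \<in> {1..n}"
  shows "(real B + 1) * (1 - x k + y k) \<ge> real B + 1 - (\<Sum>i=1..k. real (w i) * x i) \<longleftrightarrow>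
    (k \<in> greedy_prefix w B {i \<in> {1..n}. x i = 1} \<longrightarrow> y k = 1)"
proof -
  define S where "S = sum w {i \<in> {1..k}. x i = 1}"
  have eq: "{j \<in> {i \<in> {1..n}. x i = 1}. j \<le> k} = {i \<in> {1..k}. x i = 1}"
    using k by auto
  have in_prefix: "k \<in> greedy_prefix w B {i \<in> {1..n}. x i = 1} \<longleftrightarrow> x k = 1 \<and> S \<le> B"
    unfolding mem_greedy_prefix_iff eq S_def using k by simp
  have S: "(\<Sum>i=1..k. real (w i) * x i) = real S"
    using sum_mult_binary_vector[OF x, of "{1..k}" "\<lambda>i. real (w i)"] k by (simp add: S_def)
  show ?thesis
    unfolding in_prefix S
    by (rule binary_vectors_cases[OF x k]; rule binary_vectors_cases[OF y k]) auto
qed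

lemma robust_feasible_iff_ip_feasible:
  assumes mono: "mono_on {1..n} w" and xX: "x \<in> X" and x: "x \<in> binary_vectors n"
  shows "robust_feasible n p w B X x \<longleftrightarrow> (\<exists>y\<in>binary_vectors n. ip_feasible n p w B X x y)"
proof -
  define I where "I = {i \<in> {1..n}. x i = 1}"
  define G where "G = greedy_prefix w B I"
  have fin: "finite I" and mono_I: "mono_on I w"
    using mono by (auto simp: I_def intro: mono_on_subset)
  have I_sub: "I \<subseteq> {1..n}"
    by (auto simp: I_def)
  have G_sub: "G \<subseteq> I" "G \<subseteq> {1..n}"
    using greedy_prefix_subset[of w B I] by (auto simp: G_def I_def)
  have ip_iff: "ip_feasible n p w B X x y \<longleftrightarrow>
      p + card {k \<in> {1..n}. y k = 1} \<le> card I \<and> (\<forall>k\<in>G. y k = 1)"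
    if y: "y \<in> binary_vectors n" for y
    using ip_constraint_iff[OF x y, of _ B w] sum_binary_vector[OF x] sum_binary_vector[OF y]
      xX y G_sub by (auto simp: ip_feasible_def G_def I_def simp flip: of_nat_add)
  have survivors: "(\<Sum>i=1..n. (1 - c i) * x i) = real (card I) - real (card {i \<in> I. c i = 1})"
    if c: "c \<in> binary_vectors n" for c
  proof -
    have "(\<Sum>i=1..n. (1 - c i) * x i) = (\<Sum>i\<in>I. 1 - c i)"
      using sum_mult_binary_vector[OF x, of "{1..n}" "\<lambda>i. 1 - c i"] by (simp add: I_def)
    also have "\<dots> = real (card I) - (\<Sum>i\<in>I. 1 * c i)"
      by (simp add: sum_subtractf)
    also have "(\<Sum>i\<in>I. 1 * c i) = real (card {i \<in> I. c i = 1})"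
      using sum_mult_binary_vector[OF c I_sub, of "\<lambda>_. 1"] by simp
    finally show ?thesis .
  qed
  have weight: "(\<Sum>i=1..n. real (w i) * c i) = real (sum w {i \<in> {1..n}. c i = 1})"
    if "c \<in> binary_vectors n" for c
    using sum_mult_binary_vector[OF that, of "{1..n}" "\<lambda>i. real (w i)"] by simp
  show ?thesis
  proof
    assume rob: "robust_feasible n p w B X x"
    \<comment> \<open>This vector serves twice: as an attack it yields the bound on
      \<open>card G\<close>, and as \<open>y\<close> it meets the constraints of the program.
      \<open>restrict\<close> makes it extensional, as \<open>binary_vectors\<close>
      demands.\<close>
    define y where "y = restrict (\<lambda>k. of_bool (k \<in> G) :: real) {1..n}"
    have y: "y \<in> binary_vectors n"
      by (auto simp: y_def binary_vectors_def)
    have supp: "{k \<in> {1..n}. y k = 1} = G" "{k \<in> I. y k = 1} = G"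
      using G_sub by (auto simp: y_def I_def)
    have "y \<in> uncertainty_set n w B"
      using sum_greedy_prefix_le[OF fin, of w B] weight[OF y] y
      unfolding supp by (simp add: uncertainty_set_def G_def del: of_nat_sum)
    then have "real p \<le> real (card I) - real (card G)"
      using rob survivors[OF y] unfolding supp by (auto simp: robust_feasible_def)
    moreover have "y k = 1" if "k \<in> G" for k
      using that G_sub by (auto simp: y_def)
    ultimately have "ip_feasible n p w B X x y"
      unfolding ip_iff[OF y] supp by auto
    then show "\<exists>y\<in>binary_vectors n. ip_feasible n p w B X x y"
      using y by blast
  next
    assume "\<exists>y\<in>binary_vectors n. ip_feasible n p w B X x y"
    then obtain y where y: "y \<in> binary_vectors n"
      and p: "p + card {k \<in> {1..n}. y k = 1} \<le> card I" and G1: "\<forall>k\<in>G. y k = 1"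
      using ip_iff by blast
    \<comment> \<open>A feasible \<open>y\<close> may be 1 outside \<open>G\<close> too; this only
      makes the cardinality constraint stricter.\<close>
    have "card G \<le> card {k \<in> {1..n}. y k = 1}"
      using G1 G_sub by (intro card_mono) auto
    then have p_le: "p + card G \<le> card I"
      using p by simp
    have "real p \<le> (\<Sum>i=1..n. (1 - c i) * x i)" if "c \<in> uncertainty_set n w B" for c
    proof -
      have c: "c \<in> binary_vectors n" and "sum w {i \<in> {1..n}. c i = 1} \<le> B"
        using that weight by (auto simp: uncertainty_set_def simp del: of_nat_sum)
      \<comment> \<open>An attack may also hit unselected items; ignoring them keeps it within the
        budget and leaves the number of survivors unchanged.\<close>
      moreover have "sum w {i \<in> I. c i = 1} \<le> sum w {i \<in> {1..n}. c i = 1}"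
        by (intro sum_mono2) (auto simp: I_def)
      ultimately have "card {i \<in> I. c i = 1} \<le> card G"
        unfolding G_def using fin mono_I by (intro card_le_card_greedy_prefix) auto
      then show ?thesis
        using p_le survivors[OF c] by simp
    qed
    then show "robust_feasible n p w B X x"
      using xX by (auto simp: robust_feasible_def)
  qed
qed

theorem mainTheorem4:
  fixes n p B :: nat
    and d :: "nat \<Rightarrow> real"
    and w :: "nat \<Rightarrow> nat"
    and X :: "(nat \<Rightarrow> real) set"
  assumes "\<forall>i\<in>{1..n}. d i \<ge> 0"
    and "\<forall>i\<in>{1..n}. \<forall>j\<in>{1..n}. i \<le> j \<longrightarrow> w i \<le> w j"
    and "\<forall>i\<in>{1..n}. w i \<le> B"
    and "X \<subseteq> binary_vectors n"
  shows "(\<forall>x\<in>X. robust_feasible n p w B X x \<longleftrightarrow>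
            (\<exists>y\<in>binary_vectors n. ip_feasible n p w B X x y)) \<and>
         (\<forall>x\<in>X. is_arg_min (objective n d) (robust_feasible n p w B X) x \<longleftrightarrow>
            (\<exists>y\<in>binary_vectors n.
               is_arg_min (\<lambda>(x, y). objective n d x) (\<lambda>(x, y). ip_feasible n p w B X x y) (x, y)))"
proof -
  have "mono_on {1..n} w"
    using assms(2) by (auto simp: mono_on_def)
  then have feas: "robust_feasible n p w B X x \<longleftrightarrow> (\<exists>y\<in>binary_vectors n. ip_feasible n p w B X x y)"
    if "x \<in> X" for x
    using robust_feasible_iff_ip_feasible that assms(4) by blast
  have robust_in: "x \<in> X" if "robust_feasible n p w B X x" for x
    using that by (simp add: robust_feasible_def)
  have ip_in: "x \<in> X" "y \<in> binary_vectors n" if "ip_feasible n p w B X x y" for x y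
    using that by (simp_all add: ip_feasible_def)
  \<comment> \<open>Being a minimizer means that no feasible point has a strictly smaller value. As
    the objective does not depend on \<open>y\<close>, both problems have points below the same
    thresholds \<open>r\<close>; the value at \<open>x\<close> is the one used.\<close>
  have ex_iff: "(\<exists>z. robust_feasible n p w B X z \<and> objective n d z < r) \<longleftrightarrow>
      (\<exists>z y. ip_feasible n p w B X z y \<and> objective n d z < r)" for r
    using feas robust_in ip_in by metis
  show ?thesis
    using feas ex_iff by (auto simp: is_arg_min_def)
qed

end
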